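(* Let $A$ be a row-stochastic matrix of size $n>0$, and let $\mathcal{E}$ be a diagonal nonnegative matrix of size $n$ such that $A-\mathcal{E}\ge 0$ entrywise. Then the following are equivalent: (1) $A-\mathcal{E}$ is condensely anchored. (2) For all $i\in\{1,\dots,n\}$, there exists a walk in the digraph $G[A-\mathcal{E}]$ from vertex $i$ to some anchor vertex of $A-\mathcal{E}$. (3) The index of contraction $\widehat{\mathrm{con}}(A-\mathcal{E})$ is finite. (4) $A-\mathcal{E}$ is zero-convergent.
   Context: All matrices are real square matrices. A nonnegative matrix is row stochastic if each row-sum equals $1$, and row substochastic if each row-sum is at most $1$. (If $A$ is row stochastic, $\mathcal{E}$ is diagonal nonnegative and $A-\mathcal{E}\ge0$, then $A-\mathcal{E}$ is row substochastic.) A matrix $M$ is zero-convergent if $\lim_{k\to\infty}M^k=0$. The $i$-th diagonal entry of a diagonal matrix $\mathcal{E}$ is written $\mathcal{E}(i)$. The underlying digraph $G[M]$ of a matrix $M$ of size $n$ has vertex set $\{1,\dots,n\}$ and an arc $(i,j)$ if and only if $M(i,j)\neq0$ (self-loops allowed). A walk of length $k\ge0$ is a sequence of vertices $\langle i_0,\dots,i_k\rangle$ such that each $(i_t,i_{t+1})$ is an arc; walks of length $0$ are allowed; $|\omega|$ denotes the length of a walk $\omega$. A strongly connected component (SCC) is an equivalence class of the relation "$i\sim j$ iff there are walks from $i$ to $j$ and from $j$ to $i$". An SCC $W$ is a sink if every arc with initial vertex in $W$ has terminal vertex in $W$. For $A$ row stochastic and $\mathcal{E}$ diagonal nonnegative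 of the same size, an index $i$ is an anchor of $A-\mathcal{E}$ if $0<\mathcal{E}(i)<2A(i,i)$. $A-\mathcal{E}$ is condensely anchored if every sink SCC of $G[A-\mathcal{E}]$ contains an anchor of $A-\mathcal{E}$. For a row-substochastic matrix $B$ of size $n$, let $\widehat{W}_i(B)$ be the set of walks in $G[B]$ that start at $i$ and end at some vertex $j$ whose row-sum in $B$ is strictly less than $1$. The index of contraction is $\widehat{\mathrm{con}}(B)=\sup_{1\le i\le n}\inf_{\omega\in\widehat{W}_i(B)}|\omega|$, with $\inf\varnothing=\infty$. *)

theory Defs
  imports
    "Graph_Theory.Digraph_Component"
    "Graph_Theory.Vertex_Walk"
    "HOL-Analysis.Analysis"
begin

text \<open>
  A square matrix of size n > 0 is an element of \<^typ>\<open>real^'n^'n\<close>, with the finite (nonempty)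
  index type \<^typ>\<open>'n::finite\<close> in the role of {1..n}. The library order on this type is entrywise,
  so \<open>0 \<le> M\<close> says that M is a nonnegative matrix. The library multiplication \<open>M * N\<close>
  (and hence \<open>M ^ k\<close>) is entrywise as well, so matrix powers are built from \<open>**\<close>.
\<close>

definition row_sum :: "real^'n^'n \<Rightarrow> 'n \<Rightarrow> real" where
  "row_sum M i = (\<Sum>j\<in>UNIV. M $ i $ j)"

definition row_stochastic :: "real^'n^'n \<Rightarrow> bool" where
  "row_stochastic M \<longleftrightarrow> 0 \<le> M \<and> (\<forall>i. row_sum M i = 1)"

definition row_substochastic :: "real^'n^'n \<Rightarrow> bool" where
  "row_substochastic M \<longleftrightarrow> 0 \<le> M \<and> (\<forall>i. row_sum M i \<le> 1)"

definition diagonal_matrix :: "real^'n^'n \<Rightarrow> bool" where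
  "diagonal_matrix M \<longleftrightarrow> (\<forall>i j. i \<noteq> j \<longrightarrow> M $ i $ j = 0)"

primrec matrix_power :: "real^'n^'n \<Rightarrow> nat \<Rightarrow> real^'n^'n" where
  "matrix_power M 0 = mat 1"
| "matrix_power M (Suc k) = M ** matrix_power M k"

definition zero_convergent :: "real^'n^'n \<Rightarrow> bool" where
  "zero_convergent M \<longleftrightarrow> (\<lambda>k. matrix_power M k) \<longlonglongrightarrow> 0"

definition underlying_digraph :: "real^'n^'n \<Rightarrow> ('n, 'n \<times> 'n) pre_digraph" where
  "underlying_digraph M =
     \<lparr>verts = UNIV, arcs = {(i, j). M $ i $ j \<noteq> 0}, tail = fst, head = snd\<rparr>"

text \<open>
  A walk in a digraph is a \<^const>\<open>vwalk\<close>, a nonempty list of vertices; its length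
  \<^const>\<open>vwalk_length\<close> is the number of its arcs.
\<close>

definition walk_from_to :: "('a, 'b) pre_digraph \<Rightarrow> 'a \<Rightarrow> 'a list \<Rightarrow> 'a \<Rightarrow> bool" where
  "walk_from_to G i w j \<longleftrightarrow> vwalk w G \<and> hd w = i \<and> last w = j"

text \<open>
  The vertex sets of the strongly connected components are \<^const>\<open>pre_digraph.sccs_verts\<close>;
  the lemma \<open>sccs_verts_eq_quotient\<close> below identifies them with the classes of mutual
  connection by walks.
\<close>

definition sink_scc :: "('a, 'b) pre_digraph \<Rightarrow> 'a set \<Rightarrow> bool" where
  "sink_scc G W \<longleftrightarrow>
     W \<in> pre_digraph.sccs_verts G \<and> (\<forall>e\<in>arcs G. tail G e \<in> W \<longrightarrow> head G e \<in> W)"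

text \<open>The notion of anchor depends on the pair A, E and not only on the difference A - E.\<close>

definition anchor :: "real^'n^'n \<Rightarrow> real^'n^'n \<Rightarrow> 'n \<Rightarrow> bool" where
  "anchor A E i \<longleftrightarrow> 0 < E $ i $ i \<and> E $ i $ i < 2 * A $ i $ i"

definition condensely_anchored :: "real^'n^'n \<Rightarrow> real^'n^'n \<Rightarrow> bool" where
  "condensely_anchored A E \<longleftrightarrow>
     (\<forall>W. sink_scc (underlying_digraph (A - E)) W \<longrightarrow> (\<exists>i\<in>W. anchor A E i))"

definition deficient_walks :: "real^'n^'n \<Rightarrow> 'n \<Rightarrow> 'n list set" where
  "deficient_walks B i =
     {w. \<exists>j. walk_from_to (underlying_digraph B) i w j \<and> row_sum B j < 1}"

text \<open>In \<^typ>\<open>enat\<close> the infimum of the empty set is \<open>\<infinity>\<close>.\<close>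

definition contraction_index :: "real^'n^'n \<Rightarrow> enat" where
  "contraction_index B = (SUP i. INF w\<in>deficient_walks B i. enat (vwalk_length w))"

lemma wf_underlying_digraph: "wf_digraph (underlying_digraph M)"
  by unfold_locales (simp_all add: underlying_digraph_def)

lemma sccs_verts_eq_quotient:
  "pre_digraph.sccs_verts (underlying_digraph M) =
     UNIV // {(i, j). (\<exists>w. walk_from_to (underlying_digraph M) i w j) \<and>
                      (\<exists>w. walk_from_to (underlying_digraph M) j w i)}"
proof -
  interpret wf_digraph "underlying_digraph M" by (rule wf_underlying_digraph)
  have "verts (underlying_digraph M) = UNIV" by (simp add: underlying_digraph_def)
  then show ?thesis
    unfolding sccs_verts_conv_scc_of
    by (auto simp: scc_of_def quotient_def walk_from_to_def reachable_vwalk_conv)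
qed

text \<open>The index of contraction is meant for row-substochastic matrices; A - E is one.\<close>

lemma row_substochastic_diff:
  assumes "row_stochastic A" "0 \<le> E" "0 \<le> A - E"
  shows "row_substochastic (A - E)"
proof -
  have "row_sum (A - E) i \<le> row_sum A i" for i
    unfolding row_sum_def using assms(2) by (intro sum_mono) (simp add: less_eq_vec_def)
  with assms show ?thesis by (simp add: row_stochastic_def row_substochastic_def)
qed

end

theory Submission
  imports Defs
begin

text \<open>
  Write \<open>B = A - E\<close>. As \<open>E\<close> is diagonal, row \<open>i\<close> of \<open>B\<close> sums to \<open>1 - E $ i $ i\<close>; since
  \<open>E $ i $ i \<le> A $ i $ i\<close>, the anchors are exactly the rows of sum less than one. So (2) and (3) both
  say that every vertex reaches a deficient row, and (1) says the same because every vertex reaches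
  a sink component, which no walk leaves. For (4), the row sums of \<open>B\<^sup>k\<close> decrease in \<open>k\<close>; let
  \<open>s = B s\<close> be their limit. A vertex where \<open>s\<close> attains a positive maximum has row sum one and
  all its successors attain the maximum too, so it reaches no deficient row. Conversely, if \<open>i\<close>
  reaches no deficient row, then the \<open>i\<close>-th row sum of every \<open>B\<^sup>k\<close> is one.
\<close>

section \<open>Sink components and reachability\<close>

text \<open>Among the vertices reachable from \<open>u\<close>, take a \<open>v\<close> that itself
  reaches as few vertices as possible. Whatever \<open>v\<close> reaches must then reach the same
  set, hence can return to \<open>v\<close>, so no arc leaves the component of
  \<open>v\<close>.\<close>

lemma (in wf_digraph) reachable_sink_scc:
  assumes "finite (verts G)" and u: "u \<in> verts G"
  obtains W v where "sink_scc G W" "v \<in> W" "u \<rightarrow>\<^sup>* v"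
proof -
  define R where "R v = {w. v \<rightarrow>\<^sup>* w}" for v
  have fin: "finite (R v)" for v
    using assms(1) by (rule finite_subset[rotated]) (auto simp: R_def dest: reachable_in_verts)
  obtain v where uv: "u \<rightarrow>\<^sup>* v" and least: "\<And>w. u \<rightarrow>\<^sup>* w \<Longrightarrow> card (R v) \<le> card (R w)"
    using exists_least_iff[of "\<lambda>k. \<exists>v. u \<rightarrow>\<^sup>* v \<and> card (R v) = k"] u
    by (metis not_le reachable_refl)
  have return: "w \<rightarrow>\<^sup>* v" if "v \<rightarrow>\<^sup>* w" for w
  proof -
    have "R w \<subseteq> R v"
      using that by (auto simp: R_def intro: reachable_trans)
    moreover have "card (R v) \<le> card (R w)"
      using uv that by (intro least) (rule reachable_trans)
    ultimately have "R w = R v"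
      using fin by (intro card_seteq)
    then show ?thesis
      using uv by (auto simp: R_def set_eq_iff dest: reachable_in_verts)
  qed
  have v: "v \<in> verts G"
    using uv by (rule reachable_in_verts)
  have "sink_scc G (scc_of v)"
    unfolding sink_scc_def
  proof (intro conjI ballI impI)
    show "scc_of v \<in> sccs_verts"
      using v by (simp add: sccs_verts_conv_scc_of)
    fix e assume "e \<in> arcs G" "tail G e \<in> scc_of v"
    then have "v \<rightarrow>\<^sup>* head G e"
      by (auto simp: scc_of_def intro: reachable_adj_trans in_arcs_imp_in_arcs_ends)
    then show "head G e \<in> scc_of v"
      using return by (simp add: scc_of_def)
  qed
  moreover have "v \<in> scc_of v"
    using v by (rule in_scc_of_self)
  ultimately show ?thesis
    using uv that by blast
qed

lemma (in wf_digraph) reachable_in_sink_scc: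
  assumes "u \<rightarrow>\<^sup>* v" "sink_scc G W" "u \<in> W"
  shows "v \<in> W"
  using assms(1,3)
proof (induction rule: reachable_induct)
  case (step x y)
  then show ?case
    using assms(2) by (auto simp: sink_scc_def)
qed auto

text \<open>Forwards, a walk into some sink is prolonged inside it, by strong connectivity, to its
  vertex with \<open>P\<close>. Backwards, a sink is nonempty, and a walk that starts in it must end
  in it.\<close>

lemma (in wf_digraph) sink_sccs_meet_iff_reachable:
  assumes "finite (verts G)"
  shows "(\<forall>W. sink_scc G W \<longrightarrow> (\<exists>v\<in>W. P v)) \<longleftrightarrow> (\<forall>u\<in>verts G. \<exists>v. u \<rightarrow>\<^sup>* v \<and> P v)"
proof (intro iffI allI ballI impI)
  fix u assume meet: "\<forall>W. sink_scc G W \<longrightarrow> (\<exists>v\<in>W. P v)" and "u \<in> verts G"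
  then obtain W v where W: "sink_scc G W" "v \<in> W" "u \<rightarrow>\<^sup>* v"
    using assms reachable_sink_scc by blast
  then obtain w where "w \<in> W" "P w"
    using meet by blast
  moreover have "v \<rightarrow>\<^sup>* w"
    using W \<open>w \<in> W\<close> by (auto simp: sink_scc_def in_sccs_verts_conv_reachable)
  ultimately show "\<exists>v. u \<rightarrow>\<^sup>* v \<and> P v"
    using W reachable_trans by blast
next
  fix W assume reach: "\<forall>u\<in>verts G. \<exists>v. u \<rightarrow>\<^sup>* v \<and> P v" and W: "sink_scc G W"
  then obtain u where "u \<in> W" "u \<rightarrow>\<^sup>* u"
    by (auto simp: sink_scc_def in_sccs_verts_conv_reachable)
  with reach W show "\<exists>v\<in>W. P v"
    by (meson reachable_in_sink_scc reachable_in_verts(1))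
qed

section \<open>Walks in the underlying digraph and the index of contraction\<close>

lemma walk_from_to_iff_reachable:
  "(\<exists>w. walk_from_to (underlying_digraph B) i w j) \<longleftrightarrow> i \<rightarrow>\<^sup>*\<^bsub>underlying_digraph B\<^esub> j"
  by (simp add: walk_from_to_def wf_digraph.reachable_vwalk_conv[OF wf_underlying_digraph])

lemma verts_underlying_digraph [simp]: "verts (underlying_digraph B) = UNIV"
  by (simp add: underlying_digraph_def)

lemma adj_underlying_digraph [simp]: "i \<rightarrow>\<^bsub>underlying_digraph B\<^esub> j \<longleftrightarrow> B $ i $ j \<noteq> 0"
  by (force simp: underlying_digraph_def arcs_ends_def arc_to_ends_def)

text \<open>A supremum over the finite nonempty index type is finite once each infimum is. An
  infimum of walk lengths is infinite only over the empty set, since every single walk has finite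
  length.\<close>

lemma contraction_index_finite_iff:
  "contraction_index B < \<infinity> \<longleftrightarrow> (\<forall>i. \<exists>j. i \<rightarrow>\<^sup>*\<^bsub>underlying_digraph B\<^esub> j \<and> row_sum B j < 1)"
proof -
  have "contraction_index B < \<infinity> \<longleftrightarrow>
      (\<forall>i. (INF w\<in>deficient_walks B i. enat (vwalk_length w)) < \<infinity>)"
    unfolding contraction_index_def by (subst finite_Sup_less_iff) auto
  also have "\<dots> \<longleftrightarrow> (\<forall>i. deficient_walks B i \<noteq> {})"
    unfolding INF_less_iff by auto
  also have "\<dots> \<longleftrightarrow> (\<forall>i. \<exists>j. i \<rightarrow>\<^sup>*\<^bsub>underlying_digraph B\<^esub> j \<and> row_sum B j < 1)"
    unfolding deficient_walks_def walk_from_to_iff_reachable[symmetric] by blast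
  finally show ?thesis .
qed

section \<open>Row sums of matrix powers\<close>

text \<open>Row sums are the product with the all-ones vector, so those of the powers obey a
  recursion in which single entries of the powers do not occur.\<close>

lemma row_sum_mult: "row_sum (M ** N) i = (\<Sum>l\<in>UNIV. M $ i $ l * row_sum N l)"
  unfolding row_sum_def matrix_matrix_mult_def
  by (simp add: sum_distrib_left) (rule sum.swap)

lemma row_sum_mat_1 [simp]: "row_sum (mat 1) i = 1"
  by (simp add: row_sum_def mat_def if_distrib cong: if_cong)

lemma matrix_power_nonneg: "0 \<le> B \<Longrightarrow> 0 \<le> matrix_power B k"
proof (induction k)
  case 0
  show ?case by (simp add: less_eq_vec_def mat_def)
next
  case (Suc k)
  then show ?case by (auto simp: less_eq_vec_def matrix_matrix_mult_def intro!: sum_nonneg)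
qed

lemma row_sum_matrix_power_decseq:
  assumes "row_substochastic B"
  shows "decseq (\<lambda>k. row_sum (matrix_power B k) i)"
proof (rule decseq_SucI)
  fix k show "row_sum (matrix_power B (Suc k)) i \<le> row_sum (matrix_power B k) i"
  proof (induction k arbitrary: i)
    \<comment> \<open>The zeroth power is the identity, with row sums one, so the base case is
      substochasticity itself. Multiplying by the nonnegative \<open>B\<close> then preserves the
      inequality.\<close>
    case 0
    have "row_sum (matrix_power B (Suc 0)) i = row_sum B i"
      by simp
    then show ?case
      using assms by (simp add: row_substochastic_def)
  next
    case (Suc k)
    have "row_sum (B ** matrix_power B (Suc k)) i \<le> row_sum (B ** matrix_power B k) i"
      unfolding row_sum_mult using assms
      by (intro sum_mono mult_left_mono Suc.IH) (auto simp: row_substochastic_def less_eq_vec_def)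
    then show ?case by simp
  qed
qed

lemma row_sum_matrix_power_nonneg: "0 \<le> B \<Longrightarrow> 0 \<le> row_sum (matrix_power B k) i"
  using matrix_power_nonneg[of B k] by (auto simp: row_sum_def less_eq_vec_def intro: sum_nonneg)

text \<open>An entry of a nonnegative matrix lies between 0 and its row sum, so finitely many real
  sequences decide the convergence of the matrices.\<close>

lemma zero_convergent_iff_row_sum:
  assumes "0 \<le> B"
  shows "zero_convergent B \<longleftrightarrow> (\<forall>i. (\<lambda>k. row_sum (matrix_power B k) i) \<longlonglongrightarrow> 0)"
proof
  assume "zero_convergent B"
  then have "(\<lambda>k. matrix_power B k $ i $ j) \<longlonglongrightarrow> 0" for i j
    unfolding zero_convergent_def by (auto dest!: tendsto_vec_nth)
  then show "\<forall>i. (\<lambda>k. row_sum (matrix_power B k) i) \<longlonglongrightarrow> 0"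
    unfolding row_sum_def by (auto intro: tendsto_null_sum)
next
  assume lim: "\<forall>i. (\<lambda>k. row_sum (matrix_power B k) i) \<longlonglongrightarrow> 0"
  have "(\<lambda>k. matrix_power B k $ i $ j) \<longlonglongrightarrow> 0" for i j
  proof (rule real_tendsto_sandwich)
    have nonneg: "0 \<le> matrix_power B k $ i $ j" for k i j
      using matrix_power_nonneg[OF assms] by (simp add: less_eq_vec_def)
    then show "\<forall>\<^sub>F k in sequentially. 0 \<le> matrix_power B k $ i $ j"
      by simp
    show "\<forall>\<^sub>F k in sequentially. matrix_power B k $ i $ j \<le> row_sum (matrix_power B k) i"
      unfolding row_sum_def using nonneg by (intro always_eventually allI member_le_sum) auto
  qed (use lim in auto)
  then show "zero_convergent B"
    unfolding zero_convergent_def by (auto intro!: vec_tendstoI)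
qed

text \<open>The induction generalises \<open>i\<close>, because the assumption passes from
  \<open>i\<close> to all its successors.\<close>

lemma row_sum_matrix_power_eq_1:
  assumes "\<And>j. i \<rightarrow>\<^sup>*\<^bsub>underlying_digraph B\<^esub> j \<Longrightarrow> row_sum B j = 1"
  shows "row_sum (matrix_power B k) i = 1"
  using assms
proof (induction k arbitrary: i)
  case (Suc k)
  interpret wf_digraph "underlying_digraph B" by (rule wf_underlying_digraph)
  have "row_sum (matrix_power B k) l = 1" if "B $ i $ l \<noteq> 0" for l
    using that by (intro Suc.IH Suc.prems) (auto intro: adj_reachable_trans)
  \<comment> \<open>Nothing is known about the row sum at a non-successor \<open>l\<close>, but
    there its coefficient vanishes.\<close>
  then have "B $ i $ l * row_sum (matrix_power B k) l = B $ i $ l" for l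
    by (cases "B $ i $ l = 0") simp_all
  then have "row_sum (matrix_power B (Suc k)) i = row_sum B i"
    by (simp only: matrix_power.simps row_sum_mult) (simp only: row_sum_def)
  then show ?case
    using Suc.prems by simp
qed simp

text \<open>A discrete maximum principle: a combination of values at most \<open>m\<close>, with
  nonnegative weights of total at most one, equals \<open>m > 0\<close> only if the weights sum to
  one and every nonzero weight sits on the value \<open>m\<close>.\<close>

lemma maximal_fixed_vector_successors:
  fixes s :: "'n::finite \<Rightarrow> real"
  assumes B: "row_substochastic B"
    and fixed: "s i = (\<Sum>j\<in>UNIV. B $ i $ j * s j)"
    and "s i = m" "\<And>j. s j \<le> m" "0 < m"
  shows "row_sum B i = 1" and "B $ i $ j \<noteq> 0 \<Longrightarrow> s j = m"
proof -
  have nonneg: "0 \<le> B $ i $ j" for j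
    using B by (simp add: row_substochastic_def less_eq_vec_def)
  have le: "B $ i $ j * s j \<le> B $ i $ j * m" for j
    by (rule mult_left_mono[OF assms(4) nonneg])
  have "m \<le> row_sum B i * m"
    using fixed sum_mono[of UNIV, OF le] \<open>s i = m\<close> by (simp add: row_sum_def sum_distrib_right)
  then show sum: "row_sum B i = 1"
    using B \<open>0 < m\<close> by (auto simp: row_substochastic_def intro!: antisym)
  assume "B $ i $ j \<noteq> 0"
  \<comment> \<open>Both sums equal \<open>m\<close>; as the terms compare by \<open>le\<close>,
    they must agree one by one.\<close>
  have "(\<Sum>j\<in>UNIV. B $ i $ j * s j) = (\<Sum>j\<in>UNIV. B $ i $ j * m)"
    using fixed sum \<open>s i = m\<close> by (simp add: row_sum_def flip: sum_distrib_right)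
  then have "B $ i $ j * s j = B $ i $ j * m"
    by (rule sum_mono_inv[OF _ le]) simp_all
  then show "s j = m"
    using \<open>B $ i $ j \<noteq> 0\<close> by simp
qed

lemma row_sum_matrix_power_tendsto_0:
  assumes B: "row_substochastic B"
    and reach: "\<And>i. \<exists>j. i \<rightarrow>\<^sup>*\<^bsub>underlying_digraph B\<^esub> j \<and> row_sum B j < 1"
  shows "(\<lambda>k. row_sum (matrix_power B k) i) \<longlonglongrightarrow> 0"
proof -
  interpret wf_digraph "underlying_digraph B" by (rule wf_underlying_digraph)
  have nonneg: "0 \<le> row_sum (matrix_power B k) i" for k i
    using B by (simp add: row_substochastic_def row_sum_matrix_power_nonneg)
  have "\<exists>L. (\<lambda>k. row_sum (matrix_power B k) i) \<longlonglongrightarrow> L" for i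
    using decseq_convergent[OF row_sum_matrix_power_decseq[OF B], of 0 i] nonneg by metis
  then obtain s where s: "\<And>i. (\<lambda>k. row_sum (matrix_power B k) i) \<longlonglongrightarrow> s i"
    by metis
  have fixed: "s i = (\<Sum>j\<in>UNIV. B $ i $ j * s j)" for i
  \<comment> \<open>The limit of the shifted sequence is computed twice: as a shift, and through the
    recursion for row sums.\<close>
  proof (rule LIMSEQ_unique)
    show "(\<lambda>k. row_sum (matrix_power B (Suc k)) i) \<longlonglongrightarrow> s i"
      using s by (rule LIMSEQ_Suc)
    show "(\<lambda>k. row_sum (matrix_power B (Suc k)) i) \<longlonglongrightarrow> (\<Sum>j\<in>UNIV. B $ i $ j * s j)"
      by (simp add: row_sum_mult) (intro tendsto_intros s)
  qed
  define m where "m = Max (range s)"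
  have le: "s j \<le> m" for j
    by (simp add: m_def)
  have "m \<in> range s"
    unfolding m_def by (rule Max_in) auto
  then obtain i0 where i0: "s i0 = m"
    by auto
  have "m \<le> 0"
  proof (rule ccontr)
    assume "\<not> m \<le> 0"
    then have "0 < m" by simp
    note successors = maximal_fixed_vector_successors[OF B fixed _ le \<open>0 < m\<close>]
    obtain j where j: "i0 \<rightarrow>\<^sup>*\<^bsub>underlying_digraph B\<^esub> j" "row_sum B j < 1"
      using reach by blast
    from j(1) have "s j = m"
      using i0 by (induction rule: reachable_induct) (simp_all add: successors(2))
    then show False
      using successors(1) j(2) by simp
  qed
  moreover have "0 \<le> s i"
    using s nonneg by (blast intro: LIMSEQ_le_const)
  ultimately have "s i = 0"
    using le[of i] by simp
  then show ?thesis
    using s[of i] by simp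
qed

lemma zero_convergent_iff_reachable:
  assumes B: "row_substochastic B"
  shows "zero_convergent B \<longleftrightarrow> (\<forall>i. \<exists>j. i \<rightarrow>\<^sup>*\<^bsub>underlying_digraph B\<^esub> j \<and> row_sum B j < 1)"
proof -
  have "0 \<le> B" and le: "row_sum B j \<le> 1" for j
    using B by (auto simp: row_substochastic_def)
  note iff = zero_convergent_iff_row_sum[OF \<open>0 \<le> B\<close>]
  show ?thesis
  proof
    assume zero: "zero_convergent B"
    show "\<forall>i. \<exists>j. i \<rightarrow>\<^sup>*\<^bsub>underlying_digraph B\<^esub> j \<and> row_sum B j < 1"
    proof (rule ccontr)
      assume "\<not> ?thesis"
      then obtain i where "\<And>j. i \<rightarrow>\<^sup>*\<^bsub>underlying_digraph B\<^esub> j \<Longrightarrow> row_sum B j = 1"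
        using le by (metis order.not_eq_order_implies_strict)
      then have "(\<lambda>k. row_sum (matrix_power B k) i) = (\<lambda>k. 1)"
        by (simp add: row_sum_matrix_power_eq_1)
      then show False
        using zero by (metis iff LIMSEQ_const_iff zero_neq_one)
    qed
  qed (use row_sum_matrix_power_tendsto_0[OF B] iff in blast)
qed

section \<open>Anchors and the equivalence of the four conditions\<close>

lemma anchor_iff_deficient:
  assumes "row_stochastic A" "diagonal_matrix E" "0 \<le> A - E"
  shows "anchor A E i \<longleftrightarrow> row_sum (A - E) i < 1"
proof -
  have "row_sum E i = (\<Sum>j\<in>UNIV. if j = i then E $ i $ i else 0)"
    unfolding row_sum_def using assms(2) by (intro sum.cong) (auto simp: diagonal_matrix_def)
  moreover have "row_sum (A - E) i = row_sum A i - row_sum E i"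
    by (simp add: row_sum_def sum_subtractf)
  ultimately have "row_sum (A - E) i = 1 - E $ i $ i"
    using assms(1) by (simp add: row_stochastic_def)
  \<comment> \<open>Together with \<open>0 < E $ i $ i\<close> this makes the upper bound
    \<open>2 * A $ i $ i\<close> in the definition of an anchor automatic.\<close>
  moreover have "E $ i $ i \<le> A $ i $ i"
    using assms(3) by (simp add: less_eq_vec_def)
  ultimately show ?thesis
    by (auto simp: anchor_def)
qed

theorem theorem2p11:
  fixes A E :: "real^'n^'n"
  assumes "row_stochastic A"
    and "diagonal_matrix E" and "0 \<le> E"
    and "0 \<le> A - E"
  shows "(condensely_anchored A E
            \<longleftrightarrow> (\<forall>i. \<exists>w j. walk_from_to (underlying_digraph (A - E)) i w j \<and> anchor A E j))
       \<and> ((\<forall>i. \<exists>w j. walk_from_to (underlying_digraph (A - E)) i w j \<and> anchor A E j)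
            \<longleftrightarrow> contraction_index (A - E) < \<infinity>)
       \<and> (contraction_index (A - E) < \<infinity> \<longleftrightarrow> zero_convergent (A - E))"
proof -
  interpret wf_digraph "underlying_digraph (A - E)" by (rule wf_underlying_digraph)
  have anchor: "anchor A E i \<longleftrightarrow> row_sum (A - E) i < 1" for i
    using assms by (intro anchor_iff_deficient)
  have "row_substochastic (A - E)"
    using assms by (intro row_substochastic_diff)
  note zero = zero_convergent_iff_reachable[OF this]
  \<comment> \<open>Conditions (2) and (1) are brought to the form that
    \<open>contraction_index_finite_iff\<close> and \<open>zero\<close> give for (3) and
    (4).\<close>
  have "(\<exists>w j. walk_from_to (underlying_digraph (A - E)) i w j \<and> anchor A E j) \<longleftrightarrow>
      (\<exists>j. i \<rightarrow>\<^sup>*\<^bsub>underlying_digraph (A - E)\<^esub> j \<and> row_sum (A - E) j < 1)" for i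
    by (auto simp: anchor simp flip: walk_from_to_iff_reachable)
  moreover have "condensely_anchored A E \<longleftrightarrow>
      (\<forall>i. \<exists>j. i \<rightarrow>\<^sup>*\<^bsub>underlying_digraph (A - E)\<^esub> j \<and> row_sum (A - E) j < 1)"
    unfolding condensely_anchored_def anchor by (subst sink_sccs_meet_iff_reachable) simp_all
  ultimately show ?thesis
    unfolding contraction_index_finite_iff zero by simp
qed

end
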